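(* Let $p$ be analytic in the open unit disc $\mathbb{D}$ with $p(0)=1$, and let $\alpha\ge e(e-1)+1$ be a real number. If $$|1+\alpha zp'(z)+z^2p''(z)|<e\quad\text{for all } z\in\mathbb{D},$$ then $p(z)\prec e^{z}$.
   Context: $\mathbb{D}=\{z\in\mathbb{C}:|z|<1\}$. For functions $f_1,f_2$ analytic in $\mathbb{D}$, $f_1\prec f_2$ (subordination) means that there is an analytic $w:\mathbb{D}\to\mathbb{D}$ with $w(0)=0$ and $f_1=f_2\circ w$. *)

theory Defs
  imports "HOL-Complex_Analysis.Complex_Analysis"
begin

abbreviation unit_disc :: "complex set" where
  "unit_disc \<equiv> ball 0 1"

text \<open>Subordination of functions analytic in the unit disc; only the values of
  \<open>f\<^sub>1\<close> and \<open>f\<^sub>2\<close> inside the disc matter.\<close>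

definition subordinate :: "(complex \<Rightarrow> complex) \<Rightarrow> (complex \<Rightarrow> complex) \<Rightarrow> bool"
    (infix "\<prec>\<^sub>s" 50) where
  "f\<^sub>1 \<prec>\<^sub>s f\<^sub>2 \<longleftrightarrow>
     (\<exists>w. w analytic_on unit_disc \<and> w \<in> unit_disc \<rightarrow> unit_disc \<and> w 0 = 0 \<and>
          (\<forall>z\<in>unit_disc. f\<^sub>1 z = f\<^sub>2 (w z)))"

end

theory Submission
  imports Defs
begin

text \<open>
  Write \<open>e = exp 1\<close> and \<open>q(z) = 1 + \<alpha> z p'(z) + z\<^sup>2 p''(z)\<close>, so that \<open>q(0) = 1\<close> and \<open>\<bar>q\<bar> < e\<close>. The
  bound on \<open>q\<close> confines \<open>p\<close> to the disc \<open>\<bar>p - 1\<bar> < 1 - 1/e\<close>. That disc lies inside the image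
  under \<open>exp\<close> of the unit disc, because the logarithm series gives
  \<open>\<bar>Ln (1 + h)\<bar> \<le> - ln (1 - \<bar>h\<bar>) < 1\<close> there (\<open>norm_Ln_le_neg_ln\<close>). Hence
  \<open>w = Ln \<circ> p\<close> is a Schwarz function with \<open>p = exp \<circ> w\<close>.

  To bound \<open>p - 1\<close>, the differential operator is inverted one order at a time along rays. Since \<open>q\<close> is
  bounded and \<open>q(0) = 1\<close>, the Schwarz lemma gives \<open>\<bar>q(z) - 1\<bar> \<le> \<bar>z\<bar> (A + B \<bar>z\<bar>)\<close> with
  \<open>A = (e\<^sup>2 - 1)/e\<close> and \<open>B = (e + 1)/e\<close> (\<open>bounded_analytic_growth\<close>). After division by \<open>z\<close> this
  bounds \<open>\<alpha> v + z v'\<close> for \<open>v = p'\<close>. Now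
  \<open>d/dt (t\<^sup>\<alpha> v(t z)) = t\<^sup>\<alpha>\<^sup>-\<^sup>1 (\<alpha> v + \<zeta> v')(\<zeta>)\<close> at \<open>\<zeta> = t z\<close>, so
  \<open>\<bar>p'(z)\<bar> \<le> (A + B \<bar>z\<bar>)/\<alpha>\<close> (\<open>norm_le_of_euler_operator_bound\<close>). A second integration gives
  \<open>\<bar>p(z) - 1\<bar> \<le> (A + B/2)/\<alpha>\<close> (\<open>norm_diff_le_of_deriv_affine_bound\<close>), and the hypothesis
  \<open>\<alpha> \<ge> e (e - 1) + 1\<close> makes this smaller than \<open>1 - 1/e\<close> (\<open>exp_one_radius_estimate\<close>).
\<close>

section \<open>Growth of bounded analytic functions\<close>

text \<open>
  The disc automorphism argument: \<open>\<omega> = M (f - 1) / (M\<^sup>2 - f)\<close> sends the disc of radius \<open>M\<close> in the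
  \<open>f\<close>-plane to the unit disc and \<open>f = 1\<close> to \<open>0\<close>, so \<open>\<bar>\<omega>(z)\<bar> \<le> \<bar>z\<bar>\<close>. Solving for \<open>f\<close> gives the sharp
  bound \<open>\<bar>f(z) - 1\<bar> \<le> \<bar>z\<bar> (M\<^sup>2 - 1) / (M - \<bar>z\<bar>)\<close>. The fraction is convex in \<open>\<bar>z\<bar>\<close>, and the conclusion
  replaces it by its chord over \<open>[0, 1]\<close>, which is easier to integrate. Schwarz applied directly to
  \<open>f - 1\<close>, with the bound \<open>M + 1\<close>, would be too weak for the final numerical estimate.
\<close>
lemma bounded_analytic_growth:
  fixes f :: "complex \<Rightarrow> complex" and M :: real
  assumes holo: "f holomorphic_on ball 0 1" and f0: "f 0 = 1"
    and bound: "\<And>z. norm z < 1 \<Longrightarrow> norm (f z) < M"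
    and z: "norm z < 1"
  shows "norm (f z - 1) \<le> norm z * ((M\<^sup>2 - 1) / M + (M + 1) / M * norm z)"
proof -
  have M: "M > 1"
    using bound[of 0] f0 by simp
  have norm_lt: "norm (of_real M * (f x - 1)) < norm ((of_real M)\<^sup>2 - f x)" if "norm x < 1" for x
  proof -
    have "(norm (f x))\<^sup>2 < M\<^sup>2"
      using bound[OF that] by (intro power_strict_mono) auto
    moreover have "1 < M\<^sup>2"
      using M by (simp add: one_less_power)
    ultimately have "0 < (M\<^sup>2 - 1) * (M\<^sup>2 - (norm (f x))\<^sup>2)"
      by simp
    \<comment> \<open>the identity behind the Schwarz--Pick quotient; the cross terms \<open>2 M\<^sup>2 Re f\<close> cancel\<close>
    also have "\<dots> = (norm ((of_real M)\<^sup>2 - f x))\<^sup>2 - (norm (of_real M * (f x - 1)))\<^sup>2"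
      unfolding norm_mult power_mult_distrib cmod_power2 by (simp add: power2_eq_square) algebra
    finally show ?thesis
      by (simp add: power2_less_imp_less)
  qed
  have nz: "(of_real M)\<^sup>2 - f x \<noteq> 0" if "norm x < 1" for x
    using norm_lt[OF that] by (metis norm_ge_zero norm_zero not_less)
  define \<omega> where "\<omega> = (\<lambda>x. of_real M * (f x - 1) / ((of_real M)\<^sup>2 - f x))"
  have "norm (\<omega> z) \<le> norm z"
  proof (rule Schwarz_Lemma(1)[OF _ _ _ z])
    show "\<omega> holomorphic_on ball 0 1"
      unfolding \<omega>_def using nz by (intro holomorphic_intros holo) auto
    show "\<omega> 0 = 0"
      by (simp add: \<omega>_def f0)
    show "norm (\<omega> x) < 1" if "norm x < 1" for x
      using norm_lt[OF that] nz[OF that] by (simp add: \<omega>_def norm_divide divide_simps)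
  qed
  have "(f z - 1) * (of_real M + \<omega> z) = \<omega> z * of_real (M\<^sup>2 - 1)"
    using nz[OF z] by (simp add: \<omega>_def field_simps power2_eq_square)
  then have "norm (f z - 1) * norm (of_real M + \<omega> z) = norm (\<omega> z) * (M\<^sup>2 - 1)"
    using M by (metis abs_of_nonneg diff_ge_0_iff_ge less_imp_le norm_mult norm_of_real one_le_power)
  moreover have "M - norm z \<le> norm (of_real M + \<omega> z)"
    using norm_diff_ineq[of "of_real M" "\<omega> z"] \<open>norm (\<omega> z) \<le> norm z\<close> M by simp
  moreover have "norm (\<omega> z) * (M\<^sup>2 - 1) \<le> norm z * (M\<^sup>2 - 1)"
    using \<open>norm (\<omega> z) \<le> norm z\<close> M by (intro mult_right_mono) auto
  ultimately have "norm (f z - 1) * (M - norm z) \<le> norm z * (M\<^sup>2 - 1)"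
    by (smt (verit) mult_left_mono norm_ge_zero)
  then have "norm (f z - 1) \<le> norm z * ((M\<^sup>2 - 1) / (M - norm z))"
    using M z by (simp add: field_simps)
  also have "(M\<^sup>2 - 1) / (M - norm z) \<le> (M\<^sup>2 - 1) / M + (M + 1) / M * norm z"
  proof -
    have "M * (M\<^sup>2 - 1) + (M + 1) * (norm z - norm z ^ 2)
        = (M\<^sup>2 - 1 + (M + 1) * norm z) * (M - norm z)"
      by algebra
    moreover have "0 \<le> (M + 1) * (norm z - norm z ^ 2)"
      using M z by (intro mult_nonneg_nonneg) (auto simp: power2_eq_square mult_left_le)
    ultimately have "M * (M\<^sup>2 - 1) \<le> (M\<^sup>2 - 1 + (M + 1) * norm z) * (M - norm z)"
      by linarith
    then have "(M\<^sup>2 - 1) / (M - norm z) \<le> (M\<^sup>2 - 1 + (M + 1) * norm z) / M"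
      using M z by (simp add: pos_divide_le_eq pos_le_divide_eq mult.commute)
    then show ?thesis
      unfolding add_divide_distrib[of _ "(M + 1) * norm z"] by simp
  qed
  finally show ?thesis
    by (simp add: mult_left_mono)
qed

section \<open>Integration along rays\<close>

lemma ray_in_unit_disc:
  fixes z :: complex and t :: real
  assumes "norm z < 1" "0 \<le> t" "t \<le> 1"
  shows "of_real t * z \<in> ball 0 1"
  using assms mult_left_le_one_le[of "norm z" t] by (simp add: norm_mult)

lemma continuous_on_ray:
  fixes f :: "complex \<Rightarrow> complex"
  assumes "f holomorphic_on ball 0 1" "norm z < 1"
  shows "continuous_on {0..1} (\<lambda>t::real. f (of_real t * z))"
  by (rule continuous_on_compose2[OF holomorphic_on_imp_continuous_on[OF assms(1)]])
    (use ray_in_unit_disc[OF assms(2)] in \<open>auto intro!: continuous_intros\<close>)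

lemma has_vector_derivative_ray:
  fixes f :: "complex \<Rightarrow> complex"
  assumes "f holomorphic_on ball 0 1" "norm z < 1" "0 < t" "t < 1"
  shows "((\<lambda>t::real. f (of_real t * z)) has_vector_derivative z * deriv f (of_real t * z)) (at t)"
proof -
  have "(f has_field_derivative deriv f (of_real t * z)) (at (of_real t * z))"
    by (rule holomorphic_derivI[OF assms(1)])
      (use ray_in_unit_disc[of z t] assms in \<open>auto simp del: mem_ball_0\<close>)
  moreover have "((\<lambda>t::real. of_real t * z) has_vector_derivative z) (at t)"
    by (auto simp: has_vector_derivative_def scaleR_conv_of_real intro!: derivative_eq_intros)
  ultimately show ?thesis
    using field_vector_diff_chain_at[of "\<lambda>t. of_real t * z" z t f] by (simp add: o_def)
qed

text \<open>
  With the integrating factor \<open>t\<^sup>\<alpha>\<close>, the function \<open>F(t) = t\<^sup>\<alpha> v(t z)\<close> has derivative of norm at most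
  \<open>C t\<^sup>\<alpha>\<^sup>-\<^sup>1\<close>, which is the derivative of \<open>C t\<^sup>\<alpha> / \<alpha>\<close>. The mean value inequality on \<open>[0, 1]\<close> then
  compares the increments, and \<open>F(0) = 0\<close> because \<open>\<alpha> > 0\<close>.
\<close>
lemma norm_le_of_euler_operator_bound:
  fixes v :: "complex \<Rightarrow> complex" and \<alpha> C :: real
  assumes holo: "v holomorphic_on ball 0 1" and \<alpha>: "\<alpha> > 0" and z: "norm z < 1"
    and bound: "\<And>t. 0 < t \<Longrightarrow> t < 1 \<Longrightarrow>
      norm (of_real \<alpha> * v (of_real t * z) + of_real t * z * deriv v (of_real t * z)) \<le> C"
  shows "norm (v z) \<le> C / \<alpha>"
proof -
  let ?F = "\<lambda>t::real. (t powr \<alpha>) *\<^sub>R v (of_real t * z)"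
  have "norm (?F 1 - ?F 0) \<le> C / \<alpha> * 1 powr \<alpha> - C / \<alpha> * 0 powr \<alpha>"
  proof (rule differentiable_bound_general)
    show "continuous_on {0..1} ?F"
      using \<alpha> by (intro continuous_on_scaleR continuous_on_powr' continuous_on_ray[OF holo z])
        (auto intro!: continuous_intros)
    show "continuous_on {0..1} (\<lambda>t::real. C / \<alpha> * t powr \<alpha>)"
      using \<alpha> by (intro continuous_on_mult continuous_on_powr') (auto intro!: continuous_intros)
    fix t :: real
    assume t: "0 < t" "t < 1"
    let ?w = "of_real t * z"
    note dv = has_vector_derivative_ray[OF holo z t]
    have dt: "((\<lambda>t. t powr \<alpha>) has_real_derivative \<alpha> * t powr (\<alpha> - 1)) (at t)"
      using t by (auto intro!: derivative_eq_intros)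
    show "(?F has_vector_derivative (t powr (\<alpha> - 1)) *\<^sub>R
        (of_real \<alpha> * v ?w + ?w * deriv v ?w)) (at t)"
    proof (rule has_vector_derivative_eq_rhs)
      show "(?F has_vector_derivative
        (t powr \<alpha>) *\<^sub>R (z * deriv v ?w) + (\<alpha> * t powr (\<alpha> - 1)) *\<^sub>R v ?w) (at t)"
        by (rule has_vector_derivative_scaleR[OF dt dv])
      have "t powr \<alpha> = t powr (\<alpha> - 1) * t"
        using t by (simp add: powr_diff)
      then show "(t powr \<alpha>) *\<^sub>R (z * deriv v ?w) + (\<alpha> * t powr (\<alpha> - 1)) *\<^sub>R v ?w
        = (t powr (\<alpha> - 1)) *\<^sub>R (of_real \<alpha> * v ?w + ?w * deriv v ?w)"
        by (simp add: scaleR_conv_of_real algebra_simps)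
    qed
    show "((\<lambda>t. C / \<alpha> * t powr \<alpha>) has_vector_derivative t powr (\<alpha> - 1) * C) (at t)"
      using DERIV_cmult[OF dt, of "C / \<alpha>"] \<alpha>
      by (simp add: has_real_derivative_iff_has_vector_derivative mult.commute)
    show "norm ((t powr (\<alpha> - 1)) *\<^sub>R (of_real \<alpha> * v ?w + ?w * deriv v ?w)) \<le> t powr (\<alpha> - 1) * C"
      using bound[OF t] by (simp add: mult_left_mono)
  qed simp
  then show ?thesis
    by simp
qed

text \<open>
  The mean value inequality along the segment from \<open>0\<close> to \<open>z\<close>, with the antiderivative of the affine
  bound as majorant. The point \<open>x = 0\<close> is excluded from the hypothesis because a bound on \<open>p'\<close> obtained
  by dividing by \<open>x\<close> is available only elsewhere.
\<close>
lemma norm_diff_le_of_deriv_affine_bound: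
  fixes p :: "complex \<Rightarrow> complex" and A B :: real
  assumes holo: "p holomorphic_on ball 0 1" and z: "norm z < 1"
    and bound: "\<And>x. x \<noteq> 0 \<Longrightarrow> norm x < 1 \<Longrightarrow> norm (deriv p x) \<le> A + B * norm x"
  shows "norm (p z - p 0) \<le> norm z * (A + B / 2 * norm z)"
proof (cases "z = 0")
  case False
  let ?\<phi> = "\<lambda>t. norm z * (A * t + B * norm z * t\<^sup>2 / 2)"
  have "norm (p (of_real 1 * z) - p (of_real 0 * z)) \<le> ?\<phi> 1 - ?\<phi> 0"
  proof (rule differentiable_bound_general[where f = "\<lambda>t::real. p (of_real t * z)" and \<phi> = ?\<phi>])
    show "continuous_on {0..1} (\<lambda>t::real. p (of_real t * z))"
      by (rule continuous_on_ray[OF holo z])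
    show "continuous_on {0..1} ?\<phi>"
      by (intro continuous_intros) auto
    fix t :: real
    assume t: "0 < t" "t < 1"
    let ?w = "of_real t * z"
    show "((\<lambda>t. p (of_real t * z)) has_vector_derivative z * deriv p ?w) (at t)"
      by (rule has_vector_derivative_ray[OF holo z t])
    show "(?\<phi> has_vector_derivative norm z * (A + B * norm ?w)) (at t)"
      unfolding has_real_derivative_iff_has_vector_derivative[symmetric]
      using t by (auto intro!: derivative_eq_intros simp: norm_mult)
    show "norm (z * deriv p ?w) \<le> norm z * (A + B * norm ?w)"
      unfolding norm_mult[of z]
      using bound[of ?w] ray_in_unit_disc[OF z, of t] t False by (intro mult_left_mono) auto
  qed simp
  then show ?thesis
    by (simp add: algebra_simps)
qed simp

section \<open>Subordination to the exponential function\<close>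

text \<open>The Taylor coefficients of \<open>- ln (1 - x)\<close> are the absolute values of those of \<open>Ln (1 + h)\<close>.\<close>
lemma norm_Ln_le_neg_ln:
  fixes h :: complex
  assumes "norm h < 1"
  shows "norm (Ln (1 + h)) \<le> - ln (1 - norm h)"
proof -
  have *: "(\<lambda>n. norm (- ((- h) ^ n) / of_nat n)) sums (- ln (1 - norm h))"
    using sums_minus[OF ln_series'[of "- norm h"]] assms
    by (simp add: norm_divide norm_power)
  have "(\<lambda>n. - ((- h) ^ n) / of_nat n) sums Ln (1 + h)"
    by (rule Ln_series') (fact assms)
  then have "norm (Ln (1 + h)) = norm (\<Sum>n. - ((- h) ^ n) / of_nat n)"
    by (simp add: sums_iff)
  also have "\<dots> \<le> (\<Sum>n. norm (- ((- h) ^ n) / of_nat n))"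
    using * by (intro summable_norm) (simp add: sums_iff)
  also have "\<dots> = - ln (1 - norm h)"
    using * by (simp add: sums_iff)
  finally show ?thesis .
qed

text \<open>
  The radius \<open>1 - 1/e\<close> is the largest possible: it is the distance from \<open>1\<close> to the boundary
  point \<open>exp (- 1)\<close> of the image of the unit disc.
\<close>
lemma subordinate_exp_of_norm_diff_one_less:
  assumes holo: "p holomorphic_on unit_disc" and p0: "p 0 = 1"
    and bound: "\<And>z. z \<in> unit_disc \<Longrightarrow> norm (p z - 1) < 1 - exp (- 1)"
  shows "p \<prec>\<^sub>s exp"
proof -
  have bound1: "norm (p z - 1) < 1" if "z \<in> unit_disc" for z
    using bound[OF that] exp_gt_zero[of "- 1 :: real"] by linarith
  have avoid: "p z \<notin> \<real>\<^sub>\<le>\<^sub>0" if "z \<in> unit_disc" for z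
  proof
    assume "p z \<in> \<real>\<^sub>\<le>\<^sub>0"
    then have "Re (p z) \<le> 0"
      by (auto simp: complex_nonpos_Reals_iff)
    then show False
      using bound1[OF that] abs_Re_le_cmod[of "p z - 1"] by simp
  qed
  show ?thesis
    unfolding subordinate_def
  proof (intro exI conjI ballI)
    show "(\<lambda>z. Ln (p z)) analytic_on unit_disc"
      by (subst analytic_on_open) (use avoid holo in \<open>auto intro!: holomorphic_intros\<close>)
    show "(\<lambda>z. Ln (p z)) \<in> unit_disc \<rightarrow> unit_disc"
    proof
      fix z :: complex
      assume z: "z \<in> unit_disc"
      have "ln (exp (- 1)) < ln (1 - norm (p z - 1))"
        using bound[OF z] bound1[OF z] by (subst ln_less_cancel_iff) auto
      then show "Ln (p z) \<in> unit_disc"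
        using norm_Ln_le_neg_ln[OF bound1[OF z]] by simp
    qed
    show "p z = exp (Ln (p z))" if "z \<in> unit_disc" for z
      using avoid[OF that] by (metis exp_Ln nonpos_Reals_zero_I)
  qed (simp add: p0)
qed

text \<open>
  After clearing the denominator the inequality reads \<open>0 < e\<^sup>3 - 3 e\<^sup>2 + 3 e / 2 - 1 / 2\<close>, and the right
  side equals \<open>(e - 5/2) (e\<^sup>2 - e/2 + 1/4) + 1/8\<close>, where the quadratic factor has no real root.
\<close>
lemma exp_one_radius_estimate:
  fixes e :: real
  assumes e: "5 / 2 \<le> e"
  shows "(e\<^sup>2 - 1) / e + (e + 1) / e / 2 < (1 - 1 / e) * (e * (e - 1) + 1)"
proof -
  have "e\<^sup>2 - e / 2 + 1 / 4 = (e - 1 / 4)\<^sup>2 + 3 / 16"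
    by (simp add: power2_eq_square algebra_simps)
  then have "0 \<le> (e - 5 / 2) * (e\<^sup>2 - e / 2 + 1 / 4)"
    using e by simp
  then have *: "(e\<^sup>2 - 1) + (e + 1) / 2 < (e - 1) * (e * (e - 1) + 1)"
    using e by (simp add: algebra_simps power2_eq_square add_divide_distrib)
  have "(e\<^sup>2 - 1) / e + (e + 1) / e / 2 = ((e\<^sup>2 - 1) + (e + 1) / 2) / e"
    unfolding add_divide_distrib[of _ "(e + 1) / 2"] by simp
  also have "\<dots> < (e - 1) * (e * (e - 1) + 1) / e"
    using * e by (intro divide_strict_right_mono) auto
  also have "\<dots> = (e - 1) / e * (e * (e - 1) + 1)"
    by simp
  also have "(e - 1) / e = 1 - 1 / e"
    using e by (simp add: diff_divide_distrib)
  finally show ?thesis .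
qed

theorem theorem2p10:
  fixes p :: "complex \<Rightarrow> complex" and \<alpha> :: real
  assumes "p analytic_on unit_disc"
    and "p 0 = 1"
    and "\<alpha> \<ge> exp 1 * (exp 1 - 1) + 1"
    and "\<And>z. z \<in> unit_disc \<Longrightarrow>
           norm (1 + of_real \<alpha> * z * deriv p z + z\<^sup>2 * deriv (deriv p) z) < exp 1"
  shows "p \<prec>\<^sub>s exp"
proof -
  define e where "e = (exp 1 :: real)"
  define A where "A = (e\<^sup>2 - 1) / e"
  define B where "B = (e + 1) / e"
  define q where "q = (\<lambda>z. 1 + of_real \<alpha> * z * deriv p z + z\<^sup>2 * deriv (deriv p) z)"
  have e: "5 / 2 \<le> e"
    using exp_lower_Taylor_quadratic[of 1] by (simp add: e_def)
  have \<alpha>: "e * (e - 1) + 1 \<le> \<alpha>"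
    using assms(3) by (simp add: e_def)
  have "0 \<le> e * (e - 1)"
    using e by simp
  with \<alpha> have "\<alpha> > 0"
    by linarith
  have AB: "0 \<le> A" "0 \<le> B"
    using e by (auto simp: A_def B_def)
  have holo: "p holomorphic_on unit_disc"
    using assms(1) analytic_imp_holomorphic by blast
  have holo': "deriv p holomorphic_on unit_disc"
    by (rule holomorphic_deriv[OF holo]) simp
  have holo_q: "q holomorphic_on unit_disc"
    unfolding q_def by (intro holomorphic_intros holo' holomorphic_deriv[OF holo']) auto
  have growth: "norm (q x - 1) \<le> norm x * (A + B * norm x)" if "norm x < 1" for x
    unfolding A_def B_def
    by (rule bounded_analytic_growth[OF holo_q _ _ that]) (use assms(4) in \<open>auto simp: q_def e_def\<close>)
  \<comment> \<open>the factor \<open>A + B \<bar>z\<bar>\<close> increases with \<open>\<bar>z\<bar>\<close>, so its value at \<open>z\<close> serves on the whole ray to \<open>z\<close>\<close>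
  have deriv_bound: "norm (deriv p z) \<le> (A + B * norm z) / \<alpha>" if z: "z \<noteq> 0" "norm z < 1" for z
  proof (rule norm_le_of_euler_operator_bound[OF holo' \<open>\<alpha> > 0\<close> z(2)])
    fix t :: real
    assume t: "0 < t" "t < 1"
    let ?w = "of_real t * z"
    have w: "norm ?w \<le> norm z" "?w \<noteq> 0"
      using t z by (auto simp: norm_mult mult_left_le_one_le)
    have "norm ?w * norm (of_real \<alpha> * deriv p ?w + ?w * deriv (deriv p) ?w) = norm (q ?w - 1)"
      unfolding norm_mult[symmetric] q_def by (simp add: algebra_simps power2_eq_square)
    also have "\<dots> \<le> norm ?w * (A + B * norm ?w)"
      using w z by (intro growth) linarith
    finally have "norm (of_real \<alpha> * deriv p ?w + ?w * deriv (deriv p) ?w) \<le> A + B * norm ?w"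
      using w(2) by (metis mult_le_cancel_left_pos zero_less_norm_iff)
    also have "\<dots> \<le> A + B * norm z"
      using w(1) AB by (simp add: mult_left_mono)
    finally show "norm (of_real \<alpha> * deriv p ?w + ?w * deriv (deriv p) ?w) \<le> A + B * norm z" .
  qed
  show ?thesis
  proof (rule subordinate_exp_of_norm_diff_one_less[OF holo assms(2)])
    fix z :: complex
    assume "z \<in> unit_disc"
    then have z: "norm z < 1"
      by simp
    have "norm (p z - p 0) \<le> norm z * (A / \<alpha> + B / \<alpha> / 2 * norm z)"
      by (rule norm_diff_le_of_deriv_affine_bound[OF holo z])
        (use deriv_bound in \<open>simp add: add_divide_distrib\<close>)
    also have "\<dots> \<le> 1 * (A / \<alpha> + B / \<alpha> / 2 * 1)"
      using z AB \<open>\<alpha> > 0\<close> by (intro mult_mono add_mono) auto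
    also have "\<dots> = (A + B / 2) / \<alpha>"
      by (simp add: add_divide_distrib)
    also have "\<dots> < 1 - 1 / e"
    proof -
      have "A + B / 2 < (1 - 1 / e) * (e * (e - 1) + 1)"
        unfolding A_def B_def by (rule exp_one_radius_estimate[OF e])
      also have "\<dots> \<le> (1 - 1 / e) * \<alpha>"
        using \<alpha> e by (intro mult_left_mono) auto
      finally show ?thesis
        using \<open>\<alpha> > 0\<close> by (simp add: divide_less_eq)
    qed
    finally show "norm (p z - 1) < 1 - exp (- 1)"
      by (simp add: assms(2) e_def exp_minus inverse_eq_divide)
  qed
qed

end
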